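(* Suppose $\Gamma$ is a convex class of prior distributions on the unknown parameter $\theta$ of the exponential family of distributions $f(x|\theta)=\beta(\theta)t(x)e^{-\theta r(x)}$ (that is, $t\pi_0+(1-t)\pi_1\in\Gamma$ whenever $\pi_0,\pi_1\in\Gamma$ and $t\in[0,1]$), and suppose that for $\pi_0,\pi_1\in\Gamma$ and $t\in[0,1]$ the posterior expectation of $H(\theta)=\beta'(\theta)/\beta(\theta)$ under the prior $\pi_t=t\pi_0+(1-t)\pi_1$ is finite. Then there exists a prior distribution $\pi\in\Gamma$ such that $\delta_{PR}=\delta_\pi$, where $\delta_\pi$ is the Bayes estimator of $\theta$ under $\pi$ and $$\delta_{PR}=\frac{\overline{\delta}\,H(\overline{\delta})-\underline{\delta}\,H(\underline{\delta})-\log\dfrac{\beta(\overline{\delta})}{\beta(\underline{\delta})}}{H(\overline{\delta})-H(\underline{\delta})},\qquad \underline{\delta}=\inf_{\pi\in\Gamma}\delta_\pi,\quad \overline{\delta}=\sup_{\pi\in\Gamma}\delta_\pi,$$ is the posterior regret gamma-minimax (PRGM) estimator of $\theta$ in the class $\Gamma$.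
   Context: Setting. $X$ is a random variable whose distribution belongs to the one-parameter exponential family $\{f(x|\theta):x\in\chi\subseteq\mathbb{R},\ \theta\in\Theta\subseteq\mathbb{R}\}$ with density $f(x|\theta)=\beta(\theta)t(x)e^{-\theta r(x)}$ (with respect to Lebesgue or counting measure), where $r(x)>0$ and $\beta(\theta)t(x)>0$. The function $H=\beta'/\beta$ satisfies $H(\theta)=E_\theta[r(X)]$ and is decreasing. The loss function is the intrinsic (Kullback–Leibler) loss $L(\theta,\delta)=\log\frac{\beta(\theta)}{\beta(\delta)}+(\delta-\theta)H(\theta)$, $\theta,\delta\in\Theta$. For a prior $\pi$ with posterior $\pi(\cdot|x)$, the posterior risk of $\delta(x)$ is $r(x,\delta)=E[L(\theta,\delta(x))|x]$. It is minimized by the Bayes estimator $\delta_\pi(x)=H^{-1}\{E(H(\theta)|x)\}$. The posterior regret is $\rho(\delta_\pi,\delta)=r(x,\delta)-r(x,\delta_\pi)$, and the PRGM estimator over $\Gamma$ minimizes $\sup_{\pi\in\Gamma}\rho(\delta_\pi(x),\delta(x))$ over $\delta$. The displayed formula for it is stated under the assumption that $\underline{\delta}(x)$ and $\overline{\delta}(x)$ are finite almost everywhere. *)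

theory Defs
  imports "HOL-Probability.Probability"
begin

definition expfam_density ::
  "(real \<Rightarrow> real) \<Rightarrow> (real \<Rightarrow> real) \<Rightarrow> (real \<Rightarrow> real) \<Rightarrow> real \<Rightarrow> real \<Rightarrow> real"
  where "expfam_density \<beta> t r x \<theta> = \<beta> \<theta> * t x * exp (- (\<theta> * r x))"

definition log_deriv :: "(real \<Rightarrow> real) \<Rightarrow> (real \<Rightarrow> real) \<Rightarrow> real \<Rightarrow> real"
  where "log_deriv \<beta> \<beta>' \<theta> = \<beta>' \<theta> / \<beta> \<theta>"

text \<open>
  The derivative \<open>\<beta>'\<close> is taken relative to \<open>\<Theta>\<close>, hence is one-sided at an endpoint that belongs
  to \<open>\<Theta>\<close>. The parameter space is an interval and \<open>H = log_deriv \<beta> \<beta>'\<close> is strictly decreasing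
  on it, so that averages of \<open>H\<close> over \<open>\<Theta>\<close> have a unique preimage under \<open>H\<close>.
\<close>

definition exponential_family ::
  "real measure \<Rightarrow> real set \<Rightarrow> real set \<Rightarrow> (real \<Rightarrow> real) \<Rightarrow> (real \<Rightarrow> real) \<Rightarrow>
    (real \<Rightarrow> real) \<Rightarrow> (real \<Rightarrow> real) \<Rightarrow> bool"
  where "exponential_family \<mu> X \<Theta> \<beta> \<beta>' t r \<longleftrightarrow>
    (X \<in> sets borel \<and> \<mu> = restrict_space lborel X \<or> \<mu> = count_space X) \<and>
    is_interval \<Theta> \<and> \<Theta> \<noteq> {} \<and>
    t \<in> borel_measurable \<mu> \<and> r \<in> borel_measurable \<mu> \<and>
    (\<forall>x\<in>X. r x > 0) \<and>
    (\<forall>\<theta>\<in>\<Theta>. \<forall>x\<in>X. \<beta> \<theta> * t x > 0) \<and>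
    (\<forall>\<theta>\<in>\<Theta>. (\<beta> has_real_derivative \<beta>' \<theta>) (at \<theta> within \<Theta>)) \<and>
    (\<forall>\<theta>\<in>\<Theta>. prob_space (density \<mu> (\<lambda>x. ennreal (expfam_density \<beta> t r x \<theta>)))) \<and>
    (\<forall>\<theta>\<in>\<Theta>. has_bochner_integral
      (density \<mu> (\<lambda>x. ennreal (expfam_density \<beta> t r x \<theta>))) r (log_deriv \<beta> \<beta>' \<theta>)) \<and>
    strict_antimono_on \<Theta> (log_deriv \<beta> \<beta>')"

definition intrinsic_loss :: "(real \<Rightarrow> real) \<Rightarrow> (real \<Rightarrow> real) \<Rightarrow> real \<Rightarrow> real \<Rightarrow> real"
  where "intrinsic_loss \<beta> \<beta>' \<theta> d = ln (\<beta> \<theta> / \<beta> d) + (d - \<theta>) * log_deriv \<beta> \<beta>' \<theta>"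

definition is_prior :: "real set \<Rightarrow> real measure \<Rightarrow> bool"
  where "is_prior \<Theta> \<pi> \<longleftrightarrow> prob_space \<pi> \<and> sets \<pi> = sets (restrict_space borel \<Theta>)"

text \<open>\<open>mix_measure s M N\<close> is \<open>s M + (1 - s) N\<close>.\<close>

definition mix_measure :: "real \<Rightarrow> 'a measure \<Rightarrow> 'a measure \<Rightarrow> 'a measure"
  where "mix_measure s M N = measure_of (space M) (sets M)
    (\<lambda>A. ennreal s * emeasure M A + ennreal (1 - s) * emeasure N A)"

lemma sets_mix_measure [simp]: "sets (mix_measure s M N) = sets M"
  by (simp add: mix_measure_def)

lemma emeasure_mix_measure:
  assumes "sets N = sets M" and "A \<in> sets M"
  shows "emeasure (mix_measure s M N) A =
    ennreal s * emeasure M A + ennreal (1 - s) * emeasure N A"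
proof (rule emeasure_measure_of[OF mix_measure_def])
  show "sets M \<subseteq> Pow (space M)"
    by (rule sets.space_closed)
  show "A \<in> sets (mix_measure s M N)"
    using assms by simp
  show "positive (sets (mix_measure s M N))
      (\<lambda>A. ennreal s * emeasure M A + ennreal (1 - s) * emeasure N A)"
    by (simp add: positive_def)
  show "countably_additive (sets (mix_measure s M N))
      (\<lambda>A. ennreal s * emeasure M A + ennreal (1 - s) * emeasure N A)"
  proof (rule countably_additiveI)
    fix F :: "nat \<Rightarrow> 'a set"
    assume F: "range F \<subseteq> sets (mix_measure s M N)" "disjoint_family F"
    then have "(\<Sum>i. emeasure M (F i)) = emeasure M (\<Union>i. F i)"
      and "(\<Sum>i. emeasure N (F i)) = emeasure N (\<Union>i. F i)"
      using assms(1) by (auto intro!: suminf_emeasure)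
    then show "(\<Sum>i. ennreal s * emeasure M (F i) + ennreal (1 - s) * emeasure N (F i)) =
        ennreal s * emeasure M (\<Union> (range F)) + ennreal (1 - s) * emeasure N (\<Union> (range F))"
      by (simp add: suminf_add[symmetric])
  qed
qed

definition convex_class :: "'a measure set \<Rightarrow> bool"
  where "convex_class \<Gamma> \<longleftrightarrow>
    (\<forall>\<pi>\<^sub>0\<in>\<Gamma>. \<forall>\<pi>\<^sub>1\<in>\<Gamma>. \<forall>s\<in>{0..1}. mix_measure s \<pi>\<^sub>0 \<pi>\<^sub>1 \<in> \<Gamma>)"

definition marginal ::
  "(real \<Rightarrow> real) \<Rightarrow> (real \<Rightarrow> real) \<Rightarrow> (real \<Rightarrow> real) \<Rightarrow> real measure \<Rightarrow> real \<Rightarrow> ennreal"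
  where "marginal \<beta> t r \<pi> x = (\<integral>\<^sup>+\<theta>. ennreal (expfam_density \<beta> t r x \<theta>) \<partial>\<pi>)"

definition posterior ::
  "(real \<Rightarrow> real) \<Rightarrow> (real \<Rightarrow> real) \<Rightarrow> (real \<Rightarrow> real) \<Rightarrow> real measure \<Rightarrow> real \<Rightarrow> real measure"
  where "posterior \<beta> t r \<pi> x =
    density \<pi> (\<lambda>\<theta>. ennreal (expfam_density \<beta> t r x \<theta>) / marginal \<beta> t r \<pi> x)"

text \<open>
  The marginal is always positive, but it may be infinite at exceptional points \<open>x\<close>, where there
  is no posterior distribution (and \<open>posterior\<close> would be the null measure).
\<close>

definition finite_posterior_H ::
  "(real \<Rightarrow> real) \<Rightarrow> (real \<Rightarrow> real) \<Rightarrow> (real \<Rightarrow> real) \<Rightarrow> (real \<Rightarrow> real) \<Rightarrow>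
    real measure \<Rightarrow> real \<Rightarrow> bool"
  where "finite_posterior_H \<beta> \<beta>' t r \<pi> x \<longleftrightarrow>
    marginal \<beta> t r \<pi> x < \<infinity> \<and> integrable (posterior \<beta> t r \<pi> x) (log_deriv \<beta> \<beta>')"

definition bayes_estimator ::
  "real set \<Rightarrow> (real \<Rightarrow> real) \<Rightarrow> (real \<Rightarrow> real) \<Rightarrow> (real \<Rightarrow> real) \<Rightarrow> (real \<Rightarrow> real) \<Rightarrow>
    real measure \<Rightarrow> real \<Rightarrow> real"
  where "bayes_estimator \<Theta> \<beta> \<beta>' t r \<pi> x =
    the_inv_into \<Theta> (log_deriv \<beta> \<beta>') (\<integral>\<theta>. log_deriv \<beta> \<beta>' \<theta> \<partial>posterior \<beta> t r \<pi> x)"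

text \<open>
  The loss is nonnegative on \<open>\<Theta>\<close>, so its posterior expectation always exists in \<open>[0, \<infinity>]\<close>.
  When \<open>H\<close> has a finite posterior expectation, the posterior risk is either finite for all
  decisions or infinite for all of them. In the latter case the difference defining the regret is
  read as \<open>\<infinity> - \<infinity> = \<infinity>\<close>, the convention of type \<open>ereal\<close>.
\<close>

definition posterior_risk ::
  "(real \<Rightarrow> real) \<Rightarrow> (real \<Rightarrow> real) \<Rightarrow> (real \<Rightarrow> real) \<Rightarrow> (real \<Rightarrow> real) \<Rightarrow>
    real measure \<Rightarrow> real \<Rightarrow> real \<Rightarrow> ennreal"
  where "posterior_risk \<beta> \<beta>' t r \<pi> x d =
    (\<integral>\<^sup>+\<theta>. ennreal (intrinsic_loss \<beta> \<beta>' \<theta> d) \<partial>posterior \<beta> t r \<pi> x)"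

definition posterior_regret ::
  "real set \<Rightarrow> (real \<Rightarrow> real) \<Rightarrow> (real \<Rightarrow> real) \<Rightarrow> (real \<Rightarrow> real) \<Rightarrow> (real \<Rightarrow> real) \<Rightarrow>
    real measure \<Rightarrow> real \<Rightarrow> real \<Rightarrow> ereal"
  where "posterior_regret \<Theta> \<beta> \<beta>' t r \<pi> x d =
    enn2ereal (posterior_risk \<beta> \<beta>' t r \<pi> x d) -
    enn2ereal (posterior_risk \<beta> \<beta>' t r \<pi> x (bayes_estimator \<Theta> \<beta> \<beta>' t r \<pi> x))"

definition is_PRGM ::
  "real set \<Rightarrow> (real \<Rightarrow> real) \<Rightarrow> (real \<Rightarrow> real) \<Rightarrow> (real \<Rightarrow> real) \<Rightarrow> (real \<Rightarrow> real) \<Rightarrow>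
    real measure set \<Rightarrow> real \<Rightarrow> real \<Rightarrow> bool"
  where "is_PRGM \<Theta> \<beta> \<beta>' t r \<Gamma> x d \<longleftrightarrow> d \<in> \<Theta> \<and>
    (\<forall>d'\<in>\<Theta>. (SUP \<pi>\<in>\<Gamma>. posterior_regret \<Theta> \<beta> \<beta>' t r \<pi> x d)
            \<le> (SUP \<pi>\<in>\<Gamma>. posterior_regret \<Theta> \<beta> \<beta>' t r \<pi> x d'))"

text \<open>
  For \<open>lo = hi\<close> the quotient is 0/0 and is replaced by its limiting value, the common endpoint.
\<close>

definition delta_PR :: "(real \<Rightarrow> real) \<Rightarrow> (real \<Rightarrow> real) \<Rightarrow> real \<Rightarrow> real \<Rightarrow> real"
  where "delta_PR \<beta> \<beta>' lo hi =
    (if lo = hi then lo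
     else (hi * log_deriv \<beta> \<beta>' hi - lo * log_deriv \<beta> \<beta>' lo - ln (\<beta> hi / \<beta> lo)) /
          (log_deriv \<beta> \<beta>' hi - log_deriv \<beta> \<beta>' lo))"

end

theory Submission
  imports Defs
begin

text \<open>
  The loss is the Bregman divergence of the concave function \<open>ln \<beta>\<close>, whose derivative is \<open>H\<close>. When
  the Bayes risk is finite, the three-point identity turns the posterior regret of \<open>d\<close> under \<open>\<pi>\<close> into
  the loss of \<open>d\<close> at the Bayes estimator of \<open>\<pi>\<close>; when it is infinite, every regret is infinite. The
  loss is monotone on either side of \<open>d\<close>, so its supremum over Bayes estimators is governed by \<open>lo\<close> and
  \<open>hi\<close>, and \<open>delta_PR\<close> is the decision that equalizes the two. It is a Bayes estimator because it lies
  strictly between two of them (unless \<open>lo = hi\<close>): the posterior mean of \<open>H\<close> under a mixture is an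
  average of the two posterior means whose weights sweep the whole segment.
\<close>

section \<open>Bregman divergence of a function with strictly decreasing derivative\<close>

locale decreasing_derivative =
  fixes S :: "real set" and b H :: "real \<Rightarrow> real"
  assumes interval: "is_interval S"
    and deriv: "\<And>\<theta>. \<theta> \<in> S \<Longrightarrow> (b has_real_derivative H \<theta>) (at \<theta> within S)"
    and decreasing: "strict_antimono_on S H"
begin

definition bregman :: "real \<Rightarrow> real \<Rightarrow> real"
  where "bregman \<theta> d = b \<theta> - b d + (d - \<theta>) * H \<theta>"

lemma bregman_self [simp]: "bregman d d = 0"
  by (simp add: bregman_def)

lemma H_less: "l \<in> S \<Longrightarrow> u \<in> S \<Longrightarrow> l < u \<Longrightarrow> H u < H l"
  using decreasing by (simp add: monotone_on_def)

lemma H_le: "l \<in> S \<Longrightarrow> u \<in> S \<Longrightarrow> l \<le> u \<Longrightarrow> H u \<le> H l"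
  using H_less[of l u] by (cases "l = u") auto

lemma H_less_iff: "l \<in> S \<Longrightarrow> u \<in> S \<Longrightarrow> H u < H l \<longleftrightarrow> l < u"
  using H_less H_le by (meson leD not_le_imp_less)

lemma inj_on_H: "inj_on H S"
  by (rule linorder_inj_onI') (metis H_less less_irrefl)

lemma segment: "l \<in> S \<Longrightarrow> u \<in> S \<Longrightarrow> {l..u} \<subseteq> S"
  using mem_is_interval_1_I[OF interval, of l u] by auto

lemma continuous_on_b: "continuous_on S b"
  by (rule DERIV_continuous_on) (rule deriv)

lemma mean_value:
  assumes "l \<in> S" "u \<in> S" "l < u"
  obtains z where "z \<in> S" "l < z" "z < u" "b u - b l = (u - l) * H z"
proof -
  have sub: "{l..u} \<subseteq> S" by (rule segment) fact+
  have "\<exists>z\<in>{l<..<u}. b u - b l = (\<lambda>h. H z * h) (u - l)"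
  proof (rule mvt_simple[OF \<open>l < u\<close>])
    fix z assume "l \<le> z" "z \<le> u"
    then have "z \<in> S" using sub by auto
    then show "(b has_derivative (\<lambda>h. H z * h)) (at z within {l..u})"
      using DERIV_subset[OF deriv sub] by (simp add: has_field_derivative_def)
  qed
  then obtain z where z: "z \<in> {l<..<u}" "b u - b l = H z * (u - l)"
    by blast
  show thesis
    by (rule that[of z]) (use z sub in \<open>auto simp: mult.commute\<close>)
qed

text \<open>By the mean value theorem the divergence is the distance between \<open>\<theta>\<close>
  and \<open>d\<close> times the gap between \<open>H \<theta>\<close> and \<open>H\<close> at an
  intermediate point.\<close>

lemma bregman_pos:
  assumes "\<theta> \<in> S" "d \<in> S" "\<theta> \<noteq> d"
  shows "0 < bregman \<theta> d"
proof (cases "\<theta> < d")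
  case True
  then obtain z where z: "z \<in> S" "\<theta> < z" "b d - b \<theta> = (d - \<theta>) * H z"
    using mean_value assms by metis
  have "bregman \<theta> d = (d - \<theta>) * (H \<theta> - H z)"
    using z(3) by (simp add: bregman_def algebra_simps)
  then show ?thesis using True H_less assms z by simp
next
  case False
  then have "d < \<theta>" using assms by simp
  then obtain z where z: "z \<in> S" "z < \<theta>" "b \<theta> - b d = (\<theta> - d) * H z"
    using mean_value assms by metis
  have "bregman \<theta> d = (\<theta> - d) * (H z - H \<theta>)"
    using z(3) by (simp add: bregman_def algebra_simps)
  then show ?thesis using \<open>d < \<theta>\<close> H_less assms z by simp
qed

lemma bregman_nonneg: "\<theta> \<in> S \<Longrightarrow> d \<in> S \<Longrightarrow> 0 \<le> bregman \<theta> d"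
  using bregman_pos[of \<theta> d] by (cases "\<theta> = d") auto

text \<open>The cross term is affine in \<open>H \<theta>\<close>. Integrating over
  \<open>\<theta>\<close> therefore needs only the mean of \<open>H\<close>, and the cross term
  vanishes when that mean is \<open>H d'\<close>.\<close>

lemma bregman_three_point:
  "bregman \<theta> d = bregman \<theta> d' + bregman d' d + (d - d') * (H \<theta> - H d')"
  by (simp add: bregman_def algebra_simps)

text \<open>In the three-point identity through \<open>d\<close>, the cross term is nonnegative
  because \<open>H\<close> decreases, and \<open>bregman d d'\<close> is positive.\<close>

lemma bregman_less_away_right:
  assumes "\<theta> \<in> S" "d \<in> S" "d' \<in> S" "\<theta> \<le> d" "d < d'"
  shows "bregman \<theta> d < bregman \<theta> d'"
proof -
  have "0 < bregman d d'" "0 \<le> (d' - d) * (H \<theta> - H d)"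
    using assms bregman_pos H_le[of \<theta> d] by auto
  then show ?thesis using bregman_three_point[of \<theta> d' d] by simp
qed

lemma bregman_less_away_left:
  assumes "\<theta> \<in> S" "d \<in> S" "d' \<in> S" "d \<le> \<theta>" "d' < d"
  shows "bregman \<theta> d < bregman \<theta> d'"
proof -
  have "0 < bregman d d'" "0 \<le> (d' - d) * (H \<theta> - H d)"
    using assms bregman_pos H_le[of d \<theta>] by (auto intro: mult_nonpos_nonpos)
  then show ?thesis using bregman_three_point[of \<theta> d' d] by simp
qed

text \<open>Pushing \<open>\<theta>\<close> away from \<open>d\<close>, towards the endpoint on its
  own side, cannot lower the divergence: the three-point identity through \<open>\<theta>\<close>
  adds two nonnegative terms.\<close>

lemma bregman_le_max_endpoints:
  assumes "l \<in> S" "\<theta> \<in> S" "u \<in> S" "d \<in> S" "l \<le> \<theta>" "\<theta> \<le> u"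
  shows "bregman \<theta> d \<le> max (bregman l d) (bregman u d)"
proof (cases "\<theta> \<le> d")
  case True
  then have "0 \<le> bregman l \<theta>" "0 \<le> (d - \<theta>) * (H l - H \<theta>)"
    using assms bregman_nonneg H_le[of l \<theta>] by auto
  then show ?thesis using bregman_three_point[of l d \<theta>] by simp
next
  case False
  then have "0 \<le> bregman u \<theta>" "0 \<le> (d - \<theta>) * (H u - H \<theta>)"
    using assms bregman_nonneg H_le[of \<theta> u] by (auto intro: mult_nonpos_nonpos)
  then show ?thesis using bregman_three_point[of u d \<theta>] by simp
qed

text \<open>Darboux: a maximum point of \<open>b \<theta> - v \<theta>\<close> between \<open>l\<close> and \<open>u\<close> is a preimage of \<open>v\<close>.\<close>

lemma H_intermediate:
  assumes "l \<in> S" "u \<in> S" "H u \<le> v" "v \<le> H l"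
  obtains c where "c \<in> S" "H c = v"
proof -
  let ?g = "\<lambda>\<theta>. b \<theta> - v * \<theta>"
  have "l \<le> u" using assms H_less[of u l] by force
  have sub: "{l..u} \<subseteq> S" by (rule segment) fact+
  have "continuous_on {l..u} ?g"
    by (intro continuous_intros continuous_on_subset[OF continuous_on_b sub])
  then obtain c where c: "c \<in> {l..u}" and max: "\<And>\<theta>. \<theta> \<in> {l..u} \<Longrightarrow> ?g \<theta> \<le> ?g c"
    using continuous_attains_sup[of "{l..u}" ?g] \<open>l \<le> u\<close> by auto
  have "c \<in> S" using c sub by auto
  have der: "(?g has_real_derivative H c - v) (at c within {l..u})"
    using DERIV_subset[OF deriv[OF \<open>c \<in> S\<close>] sub] by (auto intro!: derivative_eq_intros)
  \<comment> \<open>The maximum may sit at an end of the interval, so only a one-sided argument is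
    available. A positive derivative at \<open>c\<close> would give larger values to the right, and
    \<open>c = u\<close> is excluded by \<open>H u \<le> v\<close>. The other inequality is the
    mirror image.\<close>
  have "H c \<le> v"
  proof (rule ccontr)
    assume *: "\<not> H c \<le> v"
    then obtain e where e: "e > 0" "\<And>h. h > 0 \<Longrightarrow> c + h \<in> {l..u} \<Longrightarrow> h < e \<Longrightarrow> ?g c < ?g (c + h)"
      using has_real_derivative_pos_inc_right[OF der] by auto
    have "c < u" using * assms c by (cases "c = u") auto
    then obtain h where "0 < h" "h < min e (u - c)"
      using e(1) dense[of 0 "min e (u - c)"] by auto
    then show False
      using e(2)[of h] max[of "c + h"] c by auto
  qed
  moreover have "v \<le> H c"
  proof (rule ccontr)
    assume *: "\<not> v \<le> H c"
    then obtain e where e: "e > 0" "\<And>h. h > 0 \<Longrightarrow> c - h \<in> {l..u} \<Longrightarrow> h < e \<Longrightarrow> ?g c < ?g (c - h)"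
      using has_real_derivative_neg_dec_left[OF der] by auto
    have "l < c" using * assms c by (cases "c = l") auto
    then obtain h where "0 < h" "h < min e (c - l)"
      using e(1) dense[of 0 "min e (c - l)"] by auto
    then show False
      using e(2)[of h] max[of "c - h"] c by auto
  qed
  ultimately show thesis using that[OF \<open>c \<in> S\<close>] by simp
qed

text \<open>A derivative need not be continuous, but a monotone function with the intermediate value
  property has no jumps.\<close>

lemma continuous_on_H: "continuous_on S H"
  unfolding continuous_on_def
proof (intro ballI order_tendstoI)
  fix c v assume c: "c \<in> S" and v: "v < H c"
  have "\<exists>e>c. \<forall>\<theta>\<in>S. \<theta> < e \<longrightarrow> v < H \<theta>"
  proof (cases "\<forall>\<theta>\<in>S. v < H \<theta>")
    case True
    then show ?thesis by (intro exI[of _ "c + 1"]) simp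
  next
    case False
    then obtain u where "u \<in> S" "H u \<le> v" by force
    \<comment> \<open>The midpoint value lies strictly between \<open>v\<close> and
      \<open>H c\<close>, so \<open>e\<close> lies strictly to the right of \<open>c\<close> while
      \<open>H\<close> still exceeds \<open>v\<close> up to \<open>e\<close>.\<close>
    then obtain e where "e \<in> S" "H e = (v + H c) / 2"
      using H_intermediate[of c u "(v + H c) / 2"] c v by auto
    then show ?thesis
      using v c H_less_iff[of c e] H_less[of _ e] by (intro exI[of _ e]) fastforce
  qed
  then show "\<forall>\<^sub>F \<theta> in at c within S. v < H \<theta>"
    by (metis (mono_tags, lifting) eventually_at_topological lessThan_iff open_lessThan)
next
  fix c v assume c: "c \<in> S" and v: "H c < v"
  have "\<exists>e<c. \<forall>\<theta>\<in>S. e < \<theta> \<longrightarrow> H \<theta> < v"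
  proof (cases "\<forall>\<theta>\<in>S. H \<theta> < v")
    case True
    then show ?thesis by (intro exI[of _ "c - 1"]) simp
  next
    case False
    then obtain u where "u \<in> S" "v \<le> H u" by force
    then obtain e where "e \<in> S" "H e = (v + H c) / 2"
      using H_intermediate[of u c "(v + H c) / 2"] c v by auto
    then show ?thesis
      using v c H_less_iff[of e c] H_less[of e] by (intro exI[of _ e]) fastforce
  qed
  then show "\<forall>\<^sub>F \<theta> in at c within S. H \<theta> < v"
    by (metis (mono_tags, lifting) eventually_at_topological greaterThan_iff open_greaterThan)
qed

lemma continuous_on_bregman: "continuous_on S (\<lambda>\<theta>. bregman \<theta> d)"
  unfolding bregman_def by (intro continuous_intros continuous_on_b continuous_on_H)

lemma expectation_H_in_image:
  assumes "prob_space P" "space P = S" "integrable P H"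
  shows "(\<integral>\<theta>. H \<theta> \<partial>P) \<in> H ` S"
proof -
  interpret prob_space P by fact
  let ?m = "\<integral>\<theta>. H \<theta> \<partial>P"
  \<comment> \<open>If \<open>H\<close> exceeded its mean everywhere, the mean would exceed itself;
    likewise below. So \<open>H\<close> takes values on both sides of its mean and the Darboux
    property applies.\<close>
  obtain u where u: "u \<in> S" "H u \<le> ?m"
    using expectation_greater[of H ?m] assms by (force simp: not_le)
  obtain l where l: "l \<in> S" "?m \<le> H l"
    using expectation_less[of H ?m] assms by (force simp: not_le)
  obtain c where "c \<in> S" "H c = ?m"
    using H_intermediate[OF l(1) u(1) u(2) l(2)] .
  then show ?thesis by (intro image_eqI[of _ _ c]) simp_all
qed

text \<open>Equality of the two divergences is a linear equation in \<open>d\<close> with slope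
  \<open>H hi - H lo\<close>, and the quotient is its solution. Positivity of
  \<open>bregman hi lo\<close> and \<open>bregman lo hi\<close> places it strictly inside.\<close>

lemma equalizer_between:
  assumes "lo \<in> S" "hi \<in> S" "lo < hi"
    and "d = (hi * H hi - lo * H lo - (b hi - b lo)) / (H hi - H lo)"
  shows "lo < d" "d < hi" "bregman lo d = bregman hi d"
proof -
  have neg: "H hi - H lo < 0" using H_less[OF assms(1-3)] by simp
  then have d: "d * (H hi - H lo) = hi * H hi - lo * H lo - (b hi - b lo)"
    using assms(4) by simp
  show "bregman lo d = bregman hi d"
    using d by (simp add: bregman_def algebra_simps)
  have "0 < bregman hi lo" "0 < bregman lo hi"
    using bregman_pos assms(1-3) by auto
  then have "d * (H hi - H lo) < lo * (H hi - H lo)" "hi * (H hi - H lo) < d * (H hi - H lo)"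
    unfolding d by (simp_all add: bregman_def algebra_simps)
  then show "lo < d" "d < hi"
    using neg by (simp_all add: mult_less_cancel_right)
qed

text \<open>
  At any other decision the loss at the farther of the two endpoints is larger, and a set having
  these endpoints as infimum and supremum comes arbitrarily close to it.
\<close>

lemma exceeds_minimax_value:
  assumes T: "T \<subseteq> S" "T \<noteq> {}" "bdd_below T" "bdd_above T"
    and lohi: "Inf T \<in> S" "Sup T \<in> S"
    and c: "c \<in> S" "Inf T \<le> c" "c \<le> Sup T"
      "bregman (Inf T) c = V" "bregman (Sup T) c = V"
    and d: "d \<in> S" "d \<noteq> c"
  obtains \<theta> where "\<theta> \<in> T" "V < bregman \<theta> d"
proof -
  obtain e where e: "e \<in> closure T" "e \<in> S" "V < bregman e d"
  proof (cases "c < d")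
    case True
    then show ?thesis
      using that[of "Inf T"] bregman_less_away_right[of "Inf T" c d] closure_contains_Inf[of T] assms by auto
  next
    case False
    then show ?thesis
      using that[of "Sup T"] bregman_less_away_left[of "Sup T" c d] closure_contains_Sup[of T] assms by auto
  qed
  have "\<forall>\<^sub>F \<theta> in at e within S. V < bregman \<theta> d"
    using continuous_on_bregman e by (intro order_tendstoD(1)) (auto simp: continuous_on_def)
  then obtain U where U: "open U" "e \<in> U" "\<forall>\<theta>\<in>U. \<theta> \<noteq> e \<longrightarrow> \<theta> \<in> S \<longrightarrow> V < bregman \<theta> d"
    by (auto simp: eventually_at_topological)
  then obtain \<theta> where "\<theta> \<in> T" "\<theta> \<in> U"
    using e(1) unfolding closure_iff_nhds_not_empty by blast
  then show thesis
    using that[of \<theta>] U T e by (cases "\<theta> = e") auto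
qed

end

section \<open>Integration against mixtures of measures\<close>

lemma space_mix_measure [simp]: "space (mix_measure s M N) = space M"
  by (simp add: mix_measure_def)

lemma mix_measure_1:
  assumes "sets N = sets M"
  shows "mix_measure 1 M N = M"
  by (rule measure_eqI) (simp_all add: emeasure_mix_measure[OF assms])

lemma nn_integral_mix_measure:
  assumes sets: "sets N = sets M" and f: "f \<in> borel_measurable M"
  shows "(\<integral>\<^sup>+\<theta>. f \<theta> \<partial>mix_measure s M N) =
    ennreal s * (\<integral>\<^sup>+\<theta>. f \<theta> \<partial>M) + ennreal (1 - s) * (\<integral>\<^sup>+\<theta>. f \<theta> \<partial>N)"
  using f
proof (induction rule: borel_measurable_induct)
  case (cong f g)
  have "integral\<^sup>N M' f = integral\<^sup>N M' g" if "space M' = space M" for M'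
    using that cong(3) by (intro nn_integral_cong) simp
  then show ?case
    using cong(4) sets_eq_imp_space_eq[OF sets] by simp
next
  case (set A)
  then show ?case
    using sets by (simp add: emeasure_mix_measure)
next
  case (mult f c)
  then have "f \<in> borel_measurable N" "f \<in> borel_measurable (mix_measure s M N)"
    using sets by (simp_all cong: measurable_cong_sets)
  with mult show ?case
    by (simp add: nn_integral_cmult distrib_left mult.left_commute)
next
  case (add f g)
  then have "f \<in> borel_measurable N" "f \<in> borel_measurable (mix_measure s M N)"
    "g \<in> borel_measurable N" "g \<in> borel_measurable (mix_measure s M N)"
    using sets by (simp_all cong: measurable_cong_sets)
  with add show ?case
    by (simp add: nn_integral_add distrib_left ac_simps)
next
  case (seq U)
  then have m: "\<And>i. U i \<in> borel_measurable N" "\<And>i. U i \<in> borel_measurable (mix_measure s M N)"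
    using sets by (simp_all cong: measurable_cong_sets)
  have SUP: "integral\<^sup>N M' (\<Squnion> (range U)) = (SUP i. integral\<^sup>N M' (U i))"
    if "\<And>i. U i \<in> borel_measurable M'" for M'
  proof -
    have "\<Squnion> (range U) = (\<lambda>\<theta>. SUP i. U i \<theta>)"
      by (simp add: fun_eq_iff image_comp)
    then show ?thesis
      using nn_integral_monotone_convergence_SUP[OF \<open>incseq U\<close> that] by simp
  qed
  have inc: "incseq (\<lambda>i. c * integral\<^sup>N M' (U i))" for c and M' :: "'a measure"
    using \<open>incseq U\<close> by (auto simp: incseq_def le_fun_def intro!: mult_left_mono nn_integral_mono)
  have "integral\<^sup>N (mix_measure s M N) (\<Squnion> (range U)) =
      (SUP i. ennreal s * integral\<^sup>N M (U i) + ennreal (1 - s) * integral\<^sup>N N (U i))"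
    using m seq.IH by (simp add: SUP)
  \<comment> \<open>The supremum of the sums splits because both sequences are increasing.\<close>
  also have "\<dots> = (SUP i. ennreal s * integral\<^sup>N M (U i)) +
      (SUP i. ennreal (1 - s) * integral\<^sup>N N (U i))"
    by (rule ennreal_SUP_add) (rule inc)+
  also have "\<dots> = ennreal s * integral\<^sup>N M (\<Squnion> (range U)) +
      ennreal (1 - s) * integral\<^sup>N N (\<Squnion> (range U))"
    using SUP[OF seq.hyps(1)] SUP[OF m(1)] by (simp add: SUP_mult_left_ennreal)
  finally show ?case .
qed

lemma integral_mix_measure:
  fixes f :: "'a \<Rightarrow> real"
  assumes sets: "sets N = sets M" and M: "integrable M f" and N: "integrable N f"
    and s: "s \<in> {0..1}"
  shows "(\<integral>\<theta>. f \<theta> \<partial>mix_measure s M N) = s * (\<integral>\<theta>. f \<theta> \<partial>M) + (1 - s) * (\<integral>\<theta>. f \<theta> \<partial>N)"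
proof -
  let ?K = "mix_measure s M N"
  have f: "f \<in> borel_measurable M" "f \<in> borel_measurable ?K"
    using M sets by (simp_all cong: measurable_cong_sets)
  \<comment> \<open>To be applied to the positive and negative parts of \<open>f\<close>. The range
    of \<open>s\<close> ensures that \<open>ennreal\<close> truncates neither weight.\<close>
  have e: "enn2real (\<integral>\<^sup>+\<theta>. g \<theta> \<partial>?K) =
      s * enn2real (\<integral>\<^sup>+\<theta>. g \<theta> \<partial>M) + (1 - s) * enn2real (\<integral>\<^sup>+\<theta>. g \<theta> \<partial>N)"
    if "g \<in> borel_measurable M" "(\<integral>\<^sup>+\<theta>. g \<theta> \<partial>M) < \<infinity>" "(\<integral>\<^sup>+\<theta>. g \<theta> \<partial>N) < \<infinity>" for g
    using that s
    by (simp add: nn_integral_mix_measure[OF sets] enn2real_plus enn2real_mult ennreal_mult_less_top)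
  have "integrable ?K f"
    using M N f by (simp add: real_integrable_def nn_integral_mix_measure[OF sets]
        ennreal_mult_eq_top_iff ennreal_add_eq_top)
  then show ?thesis
    using M N f by (simp add: real_lebesgue_integral_def e real_integrable_def less_top algebra_simps)
qed

section \<open>Priors and posteriors at a fixed observation\<close>

locale exponential_family_at =
  fixes \<mu> :: "real measure" and X \<Theta> :: "real set" and \<beta> \<beta>' t r :: "real \<Rightarrow> real" and x :: real
  assumes family: "exponential_family \<mu> X \<Theta> \<beta> \<beta>' t r"
    and x: "x \<in> X"
begin

abbreviation "H \<equiv> log_deriv \<beta> \<beta>'"
abbreviation "f \<equiv> expfam_density \<beta> t r x"
abbreviation "post \<pi> \<equiv> posterior \<beta> t r \<pi> x"
abbreviation "bayes \<pi> \<equiv> bayes_estimator \<Theta> \<beta> \<beta>' t r \<pi> x"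
abbreviation "risk \<pi> \<equiv> posterior_risk \<beta> \<beta>' t r \<pi> x"
abbreviation "regret \<pi> \<equiv> posterior_regret \<Theta> \<beta> \<beta>' t r \<pi> x"
abbreviation "admissible \<pi> \<equiv> is_prior \<Theta> \<pi> \<and> finite_posterior_H \<beta> \<beta>' t r \<pi> x"
abbreviation "mass \<pi> \<equiv> enn2real (marginal \<beta> t r \<pi> x)"

lemma \<beta>_t_pos: "\<theta> \<in> \<Theta> \<Longrightarrow> 0 < \<beta> \<theta> * t x"
  using family x by (simp add: exponential_family_def)

lemma deriv_\<beta>: "\<theta> \<in> \<Theta> \<Longrightarrow> (\<beta> has_real_derivative \<beta>' \<theta>) (at \<theta> within \<Theta>)"
  using family by (simp add: exponential_family_def)

text \<open>The factor \<open>t x\<close> makes the argument of the logarithm positive also when \<open>\<beta>\<close> is negative.\<close>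

sublocale decreasing_derivative \<Theta> "\<lambda>\<theta>. ln (\<beta> \<theta> * t x)" "log_deriv \<beta> \<beta>'"
proof
  show "is_interval \<Theta>" and "strict_antimono_on \<Theta> H"
    using family by (simp_all add: exponential_family_def)
  fix \<theta> assume \<theta>: "\<theta> \<in> \<Theta>"
  have "\<beta> \<theta> \<noteq> 0" "t x \<noteq> 0"
    using \<beta>_t_pos[OF \<theta>] by auto
  then show "((\<lambda>\<theta>. ln (\<beta> \<theta> * t x)) has_real_derivative H \<theta>) (at \<theta> within \<Theta>)"
    using \<beta>_t_pos[OF \<theta>] deriv_\<beta>[OF \<theta>]
    by (auto intro!: derivative_eq_intros simp: log_deriv_def)
qed

lemma ln_\<beta>_ratio:
  assumes "\<theta> \<in> \<Theta>" "d \<in> \<Theta>"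
  shows "ln (\<beta> \<theta> / \<beta> d) = ln (\<beta> \<theta> * t x) - ln (\<beta> d * t x)"
proof -
  have "\<beta> \<theta> / \<beta> d = (\<beta> \<theta> * t x) / (\<beta> d * t x)"
    using \<beta>_t_pos[OF assms(1)] by (cases "t x = 0") simp_all
  then show ?thesis
    using ln_divide_pos[OF \<beta>_t_pos[OF assms(1)] \<beta>_t_pos[OF assms(2)]] by simp
qed

lemma intrinsic_loss_eq_bregman:
  "\<theta> \<in> \<Theta> \<Longrightarrow> d \<in> \<Theta> \<Longrightarrow> intrinsic_loss \<beta> \<beta>' \<theta> d = bregman \<theta> d"
  by (simp add: intrinsic_loss_def bregman_def ln_\<beta>_ratio)

lemma density_pos: "\<theta> \<in> \<Theta> \<Longrightarrow> 0 < f \<theta>"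
  using \<beta>_t_pos by (simp add: expfam_density_def)

context
  fixes \<pi> assumes prior: "is_prior \<Theta> \<pi>"
begin

lemma sets_prior: "sets \<pi> = sets (restrict_space borel \<Theta>)"
  using prior by (simp add: is_prior_def)

lemma space_prior: "space \<pi> = \<Theta>"
  using sets_eq_imp_space_eq[OF sets_prior] by (simp add: space_restrict_space)

lemma borel_measurable_prior: "continuous_on \<Theta> g \<Longrightarrow> g \<in> borel_measurable \<pi>"
  for g :: "real \<Rightarrow> real"
  using borel_measurable_continuous_on_restrict measurable_cong_sets[OF sets_prior refl] by blast

lemma measurable_density: "f \<in> borel_measurable \<pi>"
proof (rule borel_measurable_prior)
  have "continuous_on \<Theta> \<beta>"
    by (rule DERIV_continuous_on) (rule deriv_\<beta>)
  then show "continuous_on \<Theta> f"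
    unfolding expfam_density_def by (intro continuous_intros)
qed

lemma measurable_H: "H \<in> borel_measurable \<pi>"
  by (rule borel_measurable_prior) (rule continuous_on_H)

text \<open>The likelihood is positive at every parameter, so it cannot vanish almost everywhere
  under a probability measure.\<close>

lemma marginal_pos: "0 < marginal \<beta> t r \<pi> x"
proof -
  interpret prob_space \<pi> using prior by (simp add: is_prior_def)
  have "\<not> (AE \<theta> in \<pi>. ennreal (f \<theta>) = 0)"
  proof
    assume "AE \<theta> in \<pi>. ennreal (f \<theta>) = 0"
    moreover have "AE \<theta> in \<pi>. ennreal (f \<theta>) \<noteq> 0"
      using density_pos by (intro AE_I2) (simp add: space_prior ennreal_eq_0_iff not_le)
    ultimately have "AE \<theta> in \<pi>. False"
      by eventually_elim simp
    then show False by simp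
  qed
  then show ?thesis
    unfolding marginal_def using measurable_density
    by (simp add: nn_integral_0_iff_AE zero_less_iff_neq_zero)
qed

lemma space_posterior: "space (post \<pi>) = \<Theta>"
  by (simp add: posterior_def space_prior)

lemma sets_posterior: "sets (post \<pi>) = sets \<pi>"
  by (simp add: posterior_def)

context
  assumes finite: "marginal \<beta> t r \<pi> x < \<infinity>"
begin

lemma mass_pos: "0 < mass \<pi>"
  using marginal_pos finite by (simp add: enn2real_positive_iff)

lemma prob_space_posterior: "prob_space (post \<pi>)"
proof
  have "emeasure (post \<pi>) (space (post \<pi>)) =
      (\<integral>\<^sup>+\<theta>. ennreal (f \<theta>) / marginal \<beta> t r \<pi> x \<partial>\<pi>)"
    unfolding posterior_def using measurable_density
    by (simp add: emeasure_density cong: nn_integral_cong)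
  also have "\<dots> = marginal \<beta> t r \<pi> x / marginal \<beta> t r \<pi> x"
    using measurable_density by (simp add: nn_integral_divide marginal_def)
  also have "\<dots> = 1"
    using marginal_pos finite by (intro ennreal_divide_self) auto
  finally show "emeasure (post \<pi>) (space (post \<pi>)) = 1" .
qed

text \<open>A real-valued density makes the rules for Bochner integrals applicable.\<close>

lemma posterior_real_density: "post \<pi> = density \<pi> (\<lambda>\<theta>. ennreal (f \<theta> / mass \<pi>))"
  unfolding posterior_def
proof (rule density_cong)
  show "AE \<theta> in \<pi>. ennreal (f \<theta>) / marginal \<beta> t r \<pi> x = ennreal (f \<theta> / mass \<pi>)"
  proof (rule AE_I2)
    fix \<theta> assume "\<theta> \<in> space \<pi>"
    then have "0 \<le> f \<theta>"
      using density_pos by (simp add: space_prior less_imp_le)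
    then show "ennreal (f \<theta>) / marginal \<beta> t r \<pi> x = ennreal (f \<theta> / mass \<pi>)"
      using mass_pos finite by (simp flip: divide_ennreal)
  qed
qed (use measurable_density in simp_all)

text \<open>Posterior means become quotients of two integrals against the prior. Each of these is
  linear in the prior, which makes mixtures tractable.\<close>

lemma
  fixes g :: "real \<Rightarrow> real"
  assumes g: "g \<in> borel_measurable \<pi>"
  shows integrable_posterior_iff:
      "integrable (post \<pi>) g \<longleftrightarrow> integrable \<pi> (\<lambda>\<theta>. f \<theta> * g \<theta>)"
    and integral_posterior: "(\<integral>\<theta>. g \<theta> \<partial>post \<pi>) = (\<integral>\<theta>. f \<theta> * g \<theta> \<partial>\<pi>) / mass \<pi>"
proof -
  have nn: "AE \<theta> in \<pi>. 0 \<le> f \<theta> / mass \<pi>"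
    using density_pos by (intro AE_I2) (simp add: space_prior less_imp_le)
  have m: "(\<lambda>\<theta>. f \<theta> / mass \<pi>) \<in> borel_measurable \<pi>"
    using measurable_density by simp
  have eq: "(f \<theta> / mass \<pi>) *\<^sub>R g \<theta> = inverse (mass \<pi>) * (f \<theta> * g \<theta>)" for \<theta>
    by (simp add: field_simps)
  show "integrable (post \<pi>) g \<longleftrightarrow> integrable \<pi> (\<lambda>\<theta>. f \<theta> * g \<theta>)"
    unfolding posterior_real_density integrable_density[OF g m nn] eq
    using mass_pos by (subst integrable_mult_left_iff) simp
  show "(\<integral>\<theta>. g \<theta> \<partial>post \<pi>) = (\<integral>\<theta>. f \<theta> * g \<theta> \<partial>\<pi>) / mass \<pi>"
    unfolding posterior_real_density integral_density[OF g m nn] eq by (simp add: divide_inverse)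
qed

end

end

text \<open>The inverse of \<open>H\<close> is applied legitimately: the posterior mean of
  \<open>H\<close> is a value of \<open>H\<close> on \<open>\<Theta>\<close>.\<close>

lemma
  assumes "admissible \<pi>"
  shows bayes_in: "bayes \<pi> \<in> \<Theta>" and H_bayes: "H (bayes \<pi>) = (\<integral>\<theta>. H \<theta> \<partial>post \<pi>)"
proof -
  have "(\<integral>\<theta>. H \<theta> \<partial>post \<pi>) \<in> H ` \<Theta>"
    using assms prob_space_posterior space_posterior
    by (intro expectation_H_in_image) (auto simp: finite_posterior_H_def)
  then show "bayes \<pi> \<in> \<Theta>" "H (bayes \<pi>) = (\<integral>\<theta>. H \<theta> \<partial>post \<pi>)"
    unfolding bayes_estimator_def
    by (auto intro: the_inv_into_into[OF inj_on_H] f_the_inv_into_f[OF inj_on_H])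
qed

section \<open>Posterior risk and regret\<close>

lemma posterior_risk_eq:
  assumes "admissible \<pi>" "d \<in> \<Theta>"
  shows "risk \<pi> d = (\<integral>\<^sup>+\<theta>. ennreal (bregman \<theta> d) \<partial>post \<pi>)"
  unfolding posterior_risk_def using assms
  by (intro nn_integral_cong) (simp add: space_posterior intrinsic_loss_eq_bregman)

lemma posterior_risk_finite_iff:
  assumes "admissible \<pi>" "d \<in> \<Theta>"
  shows "risk \<pi> d < \<infinity> \<longleftrightarrow> integrable (post \<pi>) (\<lambda>\<theta>. bregman \<theta> d)"
proof -
  have "(\<lambda>\<theta>. bregman \<theta> d) \<in> borel_measurable (post \<pi>)"
    using borel_measurable_prior[OF _ continuous_on_bregman] assms
    by (simp add: sets_posterior cong: measurable_cong_sets)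
  moreover have "(\<integral>\<^sup>+\<theta>. ennreal (norm (bregman \<theta> d)) \<partial>post \<pi>) = risk \<pi> d"
    unfolding posterior_risk_eq[OF assms] using assms bregman_nonneg
    by (intro nn_integral_cong) (simp add: space_posterior)
  ultimately show ?thesis
    by (simp add: integrable_iff_bounded)
qed

lemma risk_eq_integral:
  assumes "admissible \<pi>" "d \<in> \<Theta>" "integrable (post \<pi>) (\<lambda>\<theta>. bregman \<theta> d)"
  shows "risk \<pi> d = ennreal (\<integral>\<theta>. bregman \<theta> d \<partial>post \<pi>)"
  unfolding posterior_risk_eq[OF assms(1,2)] using assms bregman_nonneg
  by (intro nn_integral_eq_integral AE_I2) (simp_all add: space_posterior)

text \<open>This is the three-point identity integrated over the posterior. Losses at two decisions
  differ by an affine function of \<open>H\<close>, so integrability at one decision carries over to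
  all.\<close>

lemma
  assumes adm: "admissible \<pi>" and d: "d \<in> \<Theta>" "d' \<in> \<Theta>"
    and int: "integrable (post \<pi>) (\<lambda>\<theta>. bregman \<theta> d')"
  shows integrable_bregman: "integrable (post \<pi>) (\<lambda>\<theta>. bregman \<theta> d)"
    and integral_bregman: "(\<integral>\<theta>. bregman \<theta> d \<partial>post \<pi>) =
      (\<integral>\<theta>. bregman \<theta> d' \<partial>post \<pi>) + bregman d' d + (d - d') * (H (bayes \<pi>) - H d')"
proof -
  interpret prob_space "post \<pi>"
    using adm by (simp add: prob_space_posterior finite_posterior_H_def)
  have H: "integrable (post \<pi>) H"
    using adm by (simp add: finite_posterior_H_def)
  have eq: "(\<lambda>\<theta>. bregman \<theta> d) =
      (\<lambda>\<theta>. bregman \<theta> d' + bregman d' d + (d - d') * (H \<theta> - H d'))"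
    by (rule ext) (rule bregman_three_point)
  show "integrable (post \<pi>) (\<lambda>\<theta>. bregman \<theta> d)"
    unfolding eq using H int by simp
  show "(\<integral>\<theta>. bregman \<theta> d \<partial>post \<pi>) =
      (\<integral>\<theta>. bregman \<theta> d' \<partial>post \<pi>) + bregman d' d + (d - d') * (H (bayes \<pi>) - H d')"
    unfolding eq H_bayes[OF adm]
    using H int by (simp add: prob_space)
qed

text \<open>With \<open>d' = bayes \<pi>\<close> the cross term of \<open>integral_bregman\<close>
  vanishes, so subtracting the Bayes risk leaves a single divergence.\<close>

lemma regret_finite:
  assumes adm: "admissible \<pi>" and d: "d \<in> \<Theta>" and fin: "risk \<pi> (bayes \<pi>) < \<infinity>"
  shows "regret \<pi> d = ereal (bregman (bayes \<pi>) d)"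
proof -
  note b = bayes_in[OF adm]
  have int: "integrable (post \<pi>) (\<lambda>\<theta>. bregman \<theta> (bayes \<pi>))"
    using fin posterior_risk_finite_iff[OF adm b] by simp
  \<comment> \<open>Nonnegativity keeps \<open>ennreal\<close> from truncating, so the difference of
    risks is a difference of real integrals.\<close>
  have "0 \<le> (\<integral>\<theta>. bregman \<theta> d \<partial>post \<pi>)" "0 \<le> (\<integral>\<theta>. bregman \<theta> (bayes \<pi>) \<partial>post \<pi>)"
    using adm bregman_nonneg d b by (auto intro!: integral_nonneg_AE AE_I2 simp: space_posterior)
  then show ?thesis
    using integral_bregman[OF adm d b int]
    by (simp add: posterior_regret_def risk_eq_integral[OF adm d integrable_bregman[OF adm d b int]]
        risk_eq_integral[OF adm b int])
qed

text \<open>A finite risk at \<open>d\<close> would make the Bayes risk finite too. Hence the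
  minuend is infinite, and \<open>ereal\<close> subtraction returns infinity whatever is
  subtracted.\<close>

lemma regret_infinite:
  assumes adm: "admissible \<pi>" and d: "d \<in> \<Theta>" and inf: "\<not> risk \<pi> (bayes \<pi>) < \<infinity>"
  shows "regret \<pi> d = \<infinity>"
proof -
  have "\<not> risk \<pi> d < \<infinity>"
    using inf integrable_bregman[OF adm bayes_in[OF adm] d]
      posterior_risk_finite_iff[OF adm d] posterior_risk_finite_iff[OF adm bayes_in[OF adm]] by blast
  then show ?thesis
    by (simp add: posterior_regret_def less_top[symmetric])
qed

text \<open>\<open>H\<close> at the Bayes estimator of the mixture averages the two values of
  \<open>H\<close> with weights proportional to \<open>s * mass \<pi>\<^sub>0\<close> and
  \<open>(1 - s) * mass \<pi>\<^sub>1\<close>. Setting this average equal to \<open>H d\<close>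
  gives a linear equation for \<open>s\<close>.\<close>

lemma bayes_mix_measure:
  assumes adm: "admissible \<pi>\<^sub>0" "admissible \<pi>\<^sub>1" "\<And>s. s \<in> {0..1} \<Longrightarrow> admissible (mix_measure s \<pi>\<^sub>0 \<pi>\<^sub>1)"
    and d: "d \<in> \<Theta>" "bayes \<pi>\<^sub>0 < d" "d < bayes \<pi>\<^sub>1"
  obtains s where "s \<in> {0..1}" "bayes (mix_measure s \<pi>\<^sub>0 \<pi>\<^sub>1) = d"
proof -
  \<comment> \<open>The mass-weighted deviations of the two values of \<open>H\<close> from
    \<open>H d\<close>; the mixture hits \<open>H d\<close> exactly when
    \<open>s * p = (1 - s) * q\<close>.\<close>
  define p q where "p = mass \<pi>\<^sub>0 * (H (bayes \<pi>\<^sub>0) - H d)" and "q = mass \<pi>\<^sub>1 * (H d - H (bayes \<pi>\<^sub>1))"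
  have fin: "marginal \<beta> t r \<pi>\<^sub>0 x < \<infinity>" "marginal \<beta> t r \<pi>\<^sub>1 x < \<infinity>"
    using adm by (auto simp: finite_posterior_H_def)
  have pq: "0 < p" "0 < q"
    using mass_pos adm fin H_less bayes_in d by (auto simp: p_def q_def)
  define s where "s = q / (p + q)"
  have s: "s \<in> {0..1}" and "s * p = (1 - s) * q"
    using pq by (auto simp: s_def field_simps)
  let ?\<pi> = "mix_measure s \<pi>\<^sub>0 \<pi>\<^sub>1"
  note adm_s = adm(3)[OF s]
  have sets: "sets \<pi>\<^sub>1 = sets \<pi>\<^sub>0"
    using adm by (simp add: sets_prior)
  have m: "mass ?\<pi> = s * mass \<pi>\<^sub>0 + (1 - s) * mass \<pi>\<^sub>1"
    using s fin measurable_density adm(1) unfolding marginal_def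
    by (simp add: nn_integral_mix_measure[OF sets] enn2real_plus enn2real_mult ennreal_mult_less_top)
  have int: "integrable \<pi> (\<lambda>\<theta>. f \<theta> * H \<theta>)"
    "(\<integral>\<theta>. f \<theta> * H \<theta> \<partial>\<pi>) = mass \<pi> * H (bayes \<pi>)" if "admissible \<pi>" for \<pi>
    using that mass_pos[of \<pi>] measurable_H[of \<pi>]
    by (auto simp: H_bayes integral_posterior integrable_posterior_iff finite_posterior_H_def)
  have "mass ?\<pi> * H (bayes ?\<pi>) =
      s * (mass \<pi>\<^sub>0 * H (bayes \<pi>\<^sub>0)) + (1 - s) * (mass \<pi>\<^sub>1 * H (bayes \<pi>\<^sub>1))"
    using int adm adm_s by (simp add: integral_mix_measure[OF sets _ _ s] flip: int(2))
  also have "\<dots> = mass ?\<pi> * H d"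
    using \<open>s * p = (1 - s) * q\<close> by (simp add: m p_def q_def algebra_simps)
  finally have "H (bayes ?\<pi>) = H d"
    using mass_pos[of ?\<pi>] adm_s by (auto simp: finite_posterior_H_def)
  then have "bayes ?\<pi> = d"
    using inj_onD[OF inj_on_H] bayes_in[OF adm_s] d by blast
  with s show thesis by (rule that)
qed

lemma delta_PR_properties:
  assumes "lo \<in> \<Theta>" "hi \<in> \<Theta>" "lo \<le> hi"
  defines "d \<equiv> delta_PR \<beta> \<beta>' lo hi"
  shows "lo < hi \<Longrightarrow> lo < d \<and> d < hi" "lo \<le> d" "d \<le> hi" "d \<in> \<Theta>" "bregman lo d = bregman hi d"
proof -
  show strict: "lo < d \<and> d < hi" if "lo < hi"
    using equalizer_between[OF assms(1,2) that, of d] that assms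
    by (simp add: d_def delta_PR_def ln_\<beta>_ratio)
  show "lo \<le> d" "d \<le> hi"
    using strict assms by (cases "lo = hi"; force simp: d_def delta_PR_def)+
  then show "d \<in> \<Theta>"
    using segment[OF assms(1,2)] by auto
  show "bregman lo d = bregman hi d"
    using equalizer_between(3)[OF assms(1,2), of d] assms
    by (cases "lo = hi") (simp_all add: d_def delta_PR_def ln_\<beta>_ratio)
qed

end


theorem theorem3:
  fixes \<mu> :: "real measure" and X \<Theta> :: "real set"
    and \<beta> \<beta>' t r :: "real \<Rightarrow> real"
    and \<Gamma> :: "real measure set" and x lo hi :: real
  assumes family: "exponential_family \<mu> X \<Theta> \<beta> \<beta>' t r"
    and x: "x \<in> X"
    and nonempty: "\<Gamma> \<noteq> {}"
    and priors: "\<And>\<pi>. \<pi> \<in> \<Gamma> \<Longrightarrow> is_prior \<Theta> \<pi>"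
    and convex: "convex_class \<Gamma>"
    and finite_H: "\<And>\<pi>\<^sub>0 \<pi>\<^sub>1 s. \<pi>\<^sub>0 \<in> \<Gamma> \<Longrightarrow> \<pi>\<^sub>1 \<in> \<Gamma> \<Longrightarrow> s \<in> {0..1} \<Longrightarrow>
          finite_posterior_H \<beta> \<beta>' t r (mix_measure s \<pi>\<^sub>0 \<pi>\<^sub>1) x"
    and finite_lo: "bdd_below ((\<lambda>\<pi>. bayes_estimator \<Theta> \<beta> \<beta>' t r \<pi> x) ` \<Gamma>)"
    and finite_hi: "bdd_above ((\<lambda>\<pi>. bayes_estimator \<Theta> \<beta> \<beta>' t r \<pi> x) ` \<Gamma>)"
    and lo: "lo = (INF \<pi>\<in>\<Gamma>. bayes_estimator \<Theta> \<beta> \<beta>' t r \<pi> x)"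
    and hi: "hi = (SUP \<pi>\<in>\<Gamma>. bayes_estimator \<Theta> \<beta> \<beta>' t r \<pi> x)"
    and endpoints: "lo \<in> \<Theta>" "hi \<in> \<Theta>"
  shows "is_PRGM \<Theta> \<beta> \<beta>' t r \<Gamma> x (delta_PR \<beta> \<beta>' lo hi) \<and>
    ((\<forall>\<pi>\<in>\<Gamma>. posterior_risk \<beta> \<beta>' t r \<pi> x (bayes_estimator \<Theta> \<beta> \<beta>' t r \<pi> x) < \<infinity>) \<longrightarrow>
      (\<forall>d. is_PRGM \<Theta> \<beta> \<beta>' t r \<Gamma> x d \<longrightarrow> d = delta_PR \<beta> \<beta>' lo hi)) \<and>
    (\<exists>\<pi>\<in>\<Gamma>. delta_PR \<beta> \<beta>' lo hi = bayes_estimator \<Theta> \<beta> \<beta>' t r \<pi> x)"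
proof -
  interpret exponential_family_at \<mu> X \<Theta> \<beta> \<beta>' t r x
    by standard (fact family, fact x)
  let ?T = "bayes ` \<Gamma>" and ?d = "delta_PR \<beta> \<beta>' lo hi"
  have mix: "mix_measure s \<pi>\<^sub>0 \<pi>\<^sub>1 \<in> \<Gamma>" if "\<pi>\<^sub>0 \<in> \<Gamma>" "\<pi>\<^sub>1 \<in> \<Gamma>" "s \<in> {0..1}" for s \<pi>\<^sub>0 \<pi>\<^sub>1
    using convex that by (simp add: convex_class_def)
  \<comment> \<open>The mixture of a prior with itself at \<open>s = 1\<close> is that prior, so the
    hypothesis on mixtures covers single priors.\<close>
  have adm: "admissible \<pi>" if "\<pi> \<in> \<Gamma>" for \<pi>
    using finite_H[OF that that, of 1] priors[OF that] by (simp add: mix_measure_1)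
  have T: "?T \<subseteq> \<Theta>" "?T \<noteq> {}"
    using bayes_in adm nonempty by auto
  have bounds: "lo \<le> bayes \<pi>" "bayes \<pi> \<le> hi" if "\<pi> \<in> \<Gamma>" for \<pi>
    using that finite_lo finite_hi by (auto simp: lo hi intro: cINF_lower cSUP_upper)
  have "lo \<le> hi"
    using bounds nonempty by force
  note d = delta_PR_properties[OF endpoints \<open>lo \<le> hi\<close>]
  define V where "V = bregman lo ?d"
  \<comment> \<open>All Bayes estimators lie between \<open>lo\<close> and \<open>hi\<close>, where
    the divergence to \<open>?d\<close> is at most the larger endpoint value, and both endpoint
    values are \<open>V\<close>.\<close>
  have upper: "(SUP \<pi>\<in>\<Gamma>. regret \<pi> ?d) \<le> ereal V"
    if fin: "\<forall>\<pi>\<in>\<Gamma>. risk \<pi> (bayes \<pi>) < \<infinity>"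
  proof (rule SUP_least)
    fix \<pi> assume \<pi>: "\<pi> \<in> \<Gamma>"
    have "bregman (bayes \<pi>) ?d \<le> V"
      using bregman_le_max_endpoints[OF endpoints(1) _ endpoints(2) d(4)] d(5) bounds[OF \<pi>]
        bayes_in[OF adm[OF \<pi>]] by (force simp: V_def)
    then show "regret \<pi> ?d \<le> ereal V"
      using regret_finite[OF adm[OF \<pi>] d(4)] fin \<pi> by simp
  qed
  have lower: "ereal V < (SUP \<pi>\<in>\<Gamma>. regret \<pi> d')"
    if fin: "\<forall>\<pi>\<in>\<Gamma>. risk \<pi> (bayes \<pi>) < \<infinity>" and d': "d' \<in> \<Theta>" "d' \<noteq> ?d" for d'
  proof -
    obtain \<theta> where "\<theta> \<in> ?T" "V < bregman \<theta> d'"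
      by (rule exceeds_minimax_value[OF T finite_lo finite_hi _ _ d(4) _ _ _ _ d', of V])
        (use endpoints d in \<open>simp_all add: V_def flip: lo hi\<close>)
    then obtain \<pi> where "\<pi> \<in> \<Gamma>" "V < bregman (bayes \<pi>) d'"
      by blast
    then show ?thesis
      using regret_finite[OF adm d'(1)] fin by (intro less_SUP_iff[THEN iffD2]) force
  qed
  have "is_PRGM \<Theta> \<beta> \<beta>' t r \<Gamma> x ?d"
    unfolding is_PRGM_def
  proof (intro conjI ballI)
    fix d' assume d': "d' \<in> \<Theta>"
    show "(SUP \<pi>\<in>\<Gamma>. regret \<pi> ?d) \<le> (SUP \<pi>\<in>\<Gamma>. regret \<pi> d')"
    \<comment> \<open>One prior with infinite Bayes risk makes the supremum infinite at every
      decision. All decisions then tie, so uniqueness is claimed only for finite Bayes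
      risks.\<close>
    proof (cases "\<forall>\<pi>\<in>\<Gamma>. risk \<pi> (bayes \<pi>) < \<infinity>")
      case True
      then show ?thesis
        using upper lower[OF _ d'] by (cases "d' = ?d") force+
    next
      case False
      then obtain \<pi> where "\<pi> \<in> \<Gamma>" "regret \<pi> d' = \<infinity>"
        using regret_infinite[OF adm d'] by blast
      then have "(SUP \<pi>\<in>\<Gamma>. regret \<pi> d') = \<infinity>"
        using SUP_upper[of \<pi> \<Gamma> "\<lambda>\<pi>. regret \<pi> d'"] by simp
      then show ?thesis by simp
    qed
  qed (rule d(4))
  \<comment> \<open>Any other decision has worst regret strictly above \<open>V\<close>, whereas
    \<open>?d\<close> attains at most \<open>V\<close>.\<close>
  moreover have "d' = ?d"
    if "\<forall>\<pi>\<in>\<Gamma>. risk \<pi> (bayes \<pi>) < \<infinity>" "is_PRGM \<Theta> \<beta> \<beta>' t r \<Gamma> x d'" for d'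
    using lower[OF that(1), of d'] upper[OF that(1)] that(2) d(4)
    unfolding is_PRGM_def by (metis leD order.trans)
  moreover have "\<exists>\<pi>\<in>\<Gamma>. ?d = bayes \<pi>"
  proof (cases "lo = hi")
    case True
    then show ?thesis
      using bounds nonempty by (force simp: delta_PR_def)
  next
    case False
    then have "lo < ?d" "?d < hi"
      using d(1) \<open>lo \<le> hi\<close> by auto
    \<comment> \<open>The infimum and supremum need not be attained; strict inequalities on both
      sides still yield actual priors whose Bayes estimators enclose \<open>?d\<close>.\<close>
    then obtain \<pi>\<^sub>0 \<pi>\<^sub>1 where \<pi>: "\<pi>\<^sub>0 \<in> \<Gamma>" "bayes \<pi>\<^sub>0 < ?d" "\<pi>\<^sub>1 \<in> \<Gamma>" "?d < bayes \<pi>\<^sub>1"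
      using cINF_less_iff[OF nonempty finite_lo, of ?d] less_cSUP_iff[OF nonempty finite_hi, of ?d]
      unfolding lo hi by blast
    then obtain s where "s \<in> {0..1}" "bayes (mix_measure s \<pi>\<^sub>0 \<pi>\<^sub>1) = ?d"
      using bayes_mix_measure[OF adm adm adm, OF _ _ mix _ _] d(4) by metis
    then show ?thesis
      using mix \<pi> by metis
  qed
  ultimately show ?thesis by blast
qed

end
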